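(* Assume that the Bernoulli space $(\Sigma,\mathscr{A},\mu)$ is symmetric, i.e. $\theta_n=\frac12$ for all $n\ge0$. Then the canonical spectral measure $\pi_0$ is $\mathcal{S}$-smooth and its numerical spectral density $\phi_{\sigma,\tau}^{\pi_0}$ associated with $(\sigma,\tau)\in \Gamma\times \Gamma$ takes the form $$\phi_{\sigma,\tau}^{\pi_0}= Z_{\sigma\bigtriangleup \tau},$$ where $\sigma\bigtriangleup \tau = (\sigma\setminus \tau)\cup (\tau\setminus \sigma)$.
   Context: $\mathbb{N}=\{0,1,2,\dots\}$ and $\Gamma$ is the set of all finite subsets of $\mathbb{N}$. Bernoulli space: $\Sigma=\{-1,1\}^{\mathbb{N}}$, $\zeta_n(\omega)=\omega(n)$ for $\omega\in\Sigma$, $\mathscr{A}$ is the $\sigma$-field generated by $(\zeta_n)_{n\ge 0}$, and $\mu$ is the unique probability measure on $\mathscr{A}$ under which the $\zeta_n$ are independent with $\mu(\zeta_n=1)=\theta_n$, $\mu(\zeta_n=-1)=1-\theta_n$, where $0<\theta_n<1$. In the symmetric case $\theta_n=\frac12$ for all $n$, put $Z_n=\zeta_n$, $Z_\emptyset=1$ and $Z_\sigma=\prod_{i\in\sigma}Z_i$ for nonempty $\sigma\in\Gamma$. $\mathcal{L}^2=\mathcal{L}^2(\Sigma,\mathscr{A},\mu)$ is the complex Hilbert space with inner product $\langle\xi,\eta\rangle=\int_\Sigma\overline{\xi}\eta\,d\mu$; $\{Z_\sigma\mid\sigma\in\Gamma\}$ is an orthonormal basis of $\mathcal{L}^2$.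 Define $\lambda_\emptyset=1$ and $\lambda_\sigma=\prod_{k\in\sigma}(1+k)$ for nonempty $\sigma\in\Gamma$. For real $p\ge0$, $\mathcal{S}_p=\{\xi\in\mathcal{L}^2\mid \sum_{\sigma\in\Gamma}\lambda_\sigma^{2p}|\langle Z_\sigma,\xi\rangle|^2<\infty\}$, and $\mathcal{S}=\bigcap_{p\ge0}\mathcal{S}_p$. $\mathfrak{P}(\mathcal{L}^2)$ is the set of orthogonal projection operators on $\mathcal{L}^2$. A mapping $\pi\colon\mathscr{A}\to\mathfrak{P}(\mathcal{L}^2)$ is a spectral measure on $(\Sigma,\mathscr{A},\mu)$ if $\pi(\Sigma)=I$ and $\pi(\bigcup_{n\ge1}E_n)=\sum_{n\ge1}\pi(E_n)$, with convergence in the strong operator topology, for every sequence $(E_n)_{n\ge1}\subset\mathscr{A}$ of pairwise disjoint sets. It is $\mathcal{S}$-smooth if for each $(\sigma,\tau)\in\Gamma\times\Gamma$ there exists $\phi_{\sigma,\tau}^{\pi}\in\mathcal{S}$ such that $\langle\pi(E)Z_\sigma,Z_\tau\rangle=\int_E\phi_{\sigma,\tau}^{\pi}\,d\mu$ for all $E\in\mathscr{A}$; then $\phi_{\sigma,\tau}^{\pi}$ is called the numerical (spectral) density of $\pi$ associated with $(\sigma,\tau)$. The canonical spectral measure $\pi_0$ on $(\Sigma,\mathscr{A},\mu)$ is given by $\pi_0(E)\xi=\mathbf{1}_E\xi$ (pointwise product with the indicator of $E$), $E\in\mathscr{A}$, $\xi\in\mathcal{L}^2$. *)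

theory Defs
  imports "HOL-Probability.Probability"
begin

definition Sig :: "(nat \<Rightarrow> real) set" where
  "Sig = UNIV \<rightarrow>\<^sub>E {-1, 1}"

definition zeta :: "nat \<Rightarrow> (nat \<Rightarrow> real) \<Rightarrow> real" where
  "zeta n \<omega> = \<omega> n"

text \<open>The measure \<open>\<mu>\<close> is determined by \<open>\<theta>\<close>; \<open>bernoulli_space \<theta> M\<close> says that \<open>M\<close> is the
  measure space \<open>(\<Sigma>, \<A>, \<mu>)\<close> with parameters \<open>\<theta>\<close>.\<close>

locale bernoulli_space = prob_space M
  for \<theta> :: "nat \<Rightarrow> real" and M :: "(nat \<Rightarrow> real) measure" +
  assumes theta_bounds: "\<And>n. 0 < \<theta> n \<and> \<theta> n < 1"
    and space_eq: "space M = Sig"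
    and sets_eq: "sets M = sigma_sets Sig {zeta n -` B \<inter> Sig | n B. B \<in> sets borel}"
    and indep_zeta: "indep_vars (\<lambda>_. borel) zeta UNIV"
    and prob_pos: "\<And>n. prob {\<omega> \<in> space M. zeta n \<omega> = 1} = \<theta> n"
    and prob_neg: "\<And>n. prob {\<omega> \<in> space M. zeta n \<omega> = -1} = 1 - \<theta> n"

lemma bernoulli_space_exists:
  assumes "\<And>n. 0 < \<theta> n \<and> \<theta> n < 1"
  shows "\<exists>M. bernoulli_space \<theta> M"
proof -
  define g where "g b = (if b then 1 else -1 :: real)" for b
  define N where "N n = distr (measure_pmf (bernoulli_pmf (\<theta> n))) (restrict_space borel {-1, 1}) g" for n
  have g: "g \<in> measurable (measure_pmf (bernoulli_pmf (\<theta> n))) (restrict_space borel {-1, 1})" for n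
    by (auto simp: measurable_restrict_space2_iff g_def)
  have prN: "prob_space (N n)" for n
    unfolding N_def by (intro prob_space.prob_space_distr g prob_space_measure_pmf)
  have spN: "space (N n) = {-1, 1}" for n
    by (simp add: N_def space_restrict_space)
  have seN: "sets (N n) = (\<inter>) {-1, 1} ` sets borel" for n
    by (simp add: N_def sets_restrict_space)
  interpret P: product_prob_space N UNIV
    by (rule product_prob_spaceI) (rule prN)
  let ?M = "PiM UNIV N"
  have sp: "space ?M = Sig"
    by (simp add: space_PiM spN Sig_def)
  have se: "sets ?M = sigma_sets Sig {zeta n -` B \<inter> Sig | n B. B \<in> sets borel}"
  proof -
    have "{{f \<in> Sig. f i \<in> A} | i A. i \<in> UNIV \<and> A \<in> (\<inter>) {-1, 1} ` sets borel}
        = {zeta n -` B \<inter> Sig | n B. B \<in> sets borel}"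
    proof -
      have *: "{f \<in> Sig. f i \<in> {-1, 1} \<inter> B} = zeta i -` B \<inter> Sig" for i B
        by (auto simp: Sig_def zeta_def PiE_def Pi_def)
      show ?thesis
      proof (intro equalityI subsetI)
        fix x assume "x \<in> {{f \<in> Sig. f i \<in> A} | i A. i \<in> UNIV \<and> A \<in> (\<inter>) {-1, 1} ` sets borel}"
        then obtain i B where "x = {f \<in> Sig. f i \<in> {-1, 1} \<inter> B}" "B \<in> sets borel" by blast
        then show "x \<in> {zeta n -` B \<inter> Sig | n B. B \<in> sets borel}" unfolding * by blast
      next
        fix x assume "x \<in> {zeta n -` B \<inter> Sig | n B. B \<in> sets borel}"
        then show "x \<in> {{f \<in> Sig. f i \<in> A} | i A. i \<in> UNIV \<and> A \<in> (\<inter>) {-1, 1} ` sets borel}"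
          unfolding *[symmetric] by blast
      qed
    qed
    then show ?thesis
      unfolding sets_PiM_single spN seN by (simp add: Sig_def)
  qed
  have dist: "distr ?M (N i) (\<lambda>\<omega>. \<omega> i) = N i" for i
    by (rule P.PiM_component) simp
  have "P.indep_vars N (\<lambda>i \<omega>. \<omega> i) UNIV"
  proof (subst P.indep_vars_iff_distr_eq_PiM)
    show "distr ?M ?M (\<lambda>x. restrict (\<lambda>i. x i) UNIV) = PiM UNIV (\<lambda>i. distr ?M (N i) (\<lambda>\<omega>. \<omega> i))"
      by (simp add: dist restrict_UNIV)
  qed simp_all
  moreover have idN: "(\<lambda>x. x) \<in> borel_measurable (N i)" for i
    by (auto simp: N_def intro: measurable_restrict_space1)
  ultimately have ind: "P.indep_vars (\<lambda>_. borel) zeta UNIV"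
    using P.indep_vars_compose2[of N "\<lambda>i \<omega>. \<omega> i" UNIV "\<lambda>_ x. x" "\<lambda>_. borel"]
    by (simp add: zeta_def[abs_def])
  have pr: "P.prob {\<omega> \<in> space ?M. zeta n \<omega> = c}
      = measure (measure_pmf (bernoulli_pmf (\<theta> n))) {b. g b = c}" if "c \<in> {-1, 1}" for n c
  proof -
    have c: "{c} \<in> sets (N n)"
      using that unfolding seN by (intro image_eqI[of _ _ "{c}"]) auto
    have "P.prob {\<omega> \<in> space ?M. zeta n \<omega> = c} = measure (distr ?M (N n) (\<lambda>\<omega>. \<omega> n)) {c}"
      using c by (subst measure_distr) (auto simp: zeta_def vimage_def Int_def conj_commute)
    also have "\<dots> = measure (N n) {c}" by (simp add: dist)
    also have "\<dots> = measure (measure_pmf (bernoulli_pmf (\<theta> n))) {b. g b = c}"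
      using c unfolding N_def by (subst measure_distr[OF g]) (auto simp: vimage_def)
    finally show ?thesis .
  qed
  have [simp]: "{b. g b = 1} = {True}" "{b. g b = -1} = {False}"
    by (auto simp: g_def)
  have th: "0 \<le> \<theta> n" "\<theta> n \<le> 1" for n
    using assms[of n] by auto
  have "bernoulli_space \<theta> ?M"
  proof
    show "0 < \<theta> n \<and> \<theta> n < 1" for n by (rule assms)
    show "space ?M = Sig" by (rule sp)
    show "sets ?M = sigma_sets Sig {zeta n -` B \<inter> Sig | n B. B \<in> sets borel}" by (rule se)
    show "P.indep_vars (\<lambda>_. borel) zeta UNIV" by (rule ind)
    show "P.prob {\<omega> \<in> space ?M. zeta n \<omega> = 1} = \<theta> n" for n
      using th[of n] by (simp add: pr measure_pmf_single)
    show "P.prob {\<omega> \<in> space ?M. zeta n \<omega> = -1} = 1 - \<theta> n" for n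
      using th[of n] by (simp add: pr measure_pmf_single)
  qed
  then show ?thesis by blast
qed


text \<open>Elements of \<open>L\<^sup>2\<close> are classes of square integrable functions modulo equality almost
  everywhere.  Functions on \<open>space M\<close> are total functions whose values outside \<open>space M\<close> play no
  role, since \<open>AE x in M\<close> ranges over \<open>space M\<close> only.\<close>

definition sq_integrable :: "'a measure \<Rightarrow> ('a \<Rightarrow> complex) set" where
  "sq_integrable M = {f \<in> borel_measurable M. integrable M (\<lambda>x. (cmod (f x))\<^sup>2)}"

definition ae_rel :: "'a measure \<Rightarrow> (('a \<Rightarrow> complex) \<times> ('a \<Rightarrow> complex)) set" where
  "ae_rel M = {(f, g). f \<in> sq_integrable M \<and> g \<in> sq_integrable M \<and> (AE x in M. f x = g x)}"

type_synonym 'a l2 = "('a \<Rightarrow> complex) set"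

definition L2 :: "'a measure \<Rightarrow> 'a l2 set" where
  "L2 M = sq_integrable M // ae_rel M"

definition cls :: "'a measure \<Rightarrow> ('a \<Rightarrow> complex) \<Rightarrow> 'a l2" where
  "cls M f = ae_rel M `` {f}"

definition rep :: "'a l2 \<Rightarrow> 'a \<Rightarrow> complex" where
  "rep \<xi> = (SOME f. f \<in> \<xi>)"

definition l2_add :: "'a measure \<Rightarrow> 'a l2 \<Rightarrow> 'a l2 \<Rightarrow> 'a l2" where
  "l2_add M \<xi> \<eta> = cls M (\<lambda>x. rep \<xi> x + rep \<eta> x)"

definition l2_scale :: "'a measure \<Rightarrow> complex \<Rightarrow> 'a l2 \<Rightarrow> 'a l2" where
  "l2_scale M c \<xi> = cls M (\<lambda>x. c * rep \<xi> x)"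

definition l2_diff :: "'a measure \<Rightarrow> 'a l2 \<Rightarrow> 'a l2 \<Rightarrow> 'a l2" where
  "l2_diff M \<xi> \<eta> = cls M (\<lambda>x. rep \<xi> x - rep \<eta> x)"

primrec l2_partial_sum :: "'a measure \<Rightarrow> (nat \<Rightarrow> 'a l2) \<Rightarrow> nat \<Rightarrow> 'a l2" where
  "l2_partial_sum M F 0 = cls M (\<lambda>_. 0)"
| "l2_partial_sum M F (Suc n) = l2_add M (l2_partial_sum M F n) (F n)"

definition l2_inner :: "'a measure \<Rightarrow> 'a l2 \<Rightarrow> 'a l2 \<Rightarrow> complex" where
  "l2_inner M \<xi> \<eta> = (LINT x|M. cnj (rep \<xi> x) * rep \<eta> x)"

definition l2_norm :: "'a measure \<Rightarrow> 'a l2 \<Rightarrow> real" where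
  "l2_norm M \<xi> = sqrt (Re (l2_inner M \<xi> \<xi>))"


text \<open>Operators are functions whose values outside the carrier \<open>L2 M\<close> are irrelevant.\<close>

definition bounded_operator :: "'a measure \<Rightarrow> ('a l2 \<Rightarrow> 'a l2) \<Rightarrow> bool" where
  "bounded_operator M P \<longleftrightarrow>
     (\<forall>\<xi>\<in>L2 M. P \<xi> \<in> L2 M) \<and>
     (\<forall>\<xi>\<in>L2 M. \<forall>\<eta>\<in>L2 M. P (l2_add M \<xi> \<eta>) = l2_add M (P \<xi>) (P \<eta>)) \<and>
     (\<forall>c. \<forall>\<xi>\<in>L2 M. P (l2_scale M c \<xi>) = l2_scale M c (P \<xi>)) \<and>
     (\<exists>C. \<forall>\<xi>\<in>L2 M. l2_norm M (P \<xi>) \<le> C * l2_norm M \<xi>)"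

definition orthogonal_projection :: "'a measure \<Rightarrow> ('a l2 \<Rightarrow> 'a l2) \<Rightarrow> bool" where
  "orthogonal_projection M P \<longleftrightarrow>
     bounded_operator M P \<and>
     (\<forall>\<xi>\<in>L2 M. P (P \<xi>) = P \<xi>) \<and>
     (\<forall>\<xi>\<in>L2 M. \<forall>\<eta>\<in>L2 M. l2_inner M (P \<xi>) \<eta> = l2_inner M \<xi> (P \<eta>))"

definition spectral_measure :: "'a measure \<Rightarrow> ('a set \<Rightarrow> 'a l2 \<Rightarrow> 'a l2) \<Rightarrow> bool" where
  "spectral_measure M \<pi> \<longleftrightarrow>
     (\<forall>E\<in>sets M. orthogonal_projection M (\<pi> E)) \<and>
     (\<forall>\<xi>\<in>L2 M. \<pi> (space M) \<xi> = \<xi>) \<and>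
     (\<forall>E. range E \<subseteq> sets M \<longrightarrow> disjoint_family E \<longrightarrow>
        (\<forall>\<xi>\<in>L2 M.
          (\<lambda>N. l2_norm M (l2_diff M (l2_partial_sum M (\<lambda>n. \<pi> (E n) \<xi>) N) (\<pi> (\<Union>n. E n) \<xi>)))
            \<longlonglongrightarrow> 0))"

definition canonical_spectral_measure :: "'a measure \<Rightarrow> 'a set \<Rightarrow> 'a l2 \<Rightarrow> 'a l2" where
  "canonical_spectral_measure M E \<xi> = cls M (\<lambda>x. indicator E x * rep \<xi> x)"


definition Gam :: "nat set set" where
  "Gam = {\<sigma>. finite \<sigma>}"

text \<open>\<open>Z\<^sub>\<sigma>\<close> of the symmetric case, where \<open>Z\<^sub>n = \<zeta>\<^sub>n\<close>.\<close>

definition Z :: "(nat \<Rightarrow> real) measure \<Rightarrow> nat set \<Rightarrow> (nat \<Rightarrow> real) l2" where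
  "Z M \<sigma> = cls M (\<lambda>\<omega>. complex_of_real (\<Prod>i\<in>\<sigma>. zeta i \<omega>))"

definition lam :: "nat set \<Rightarrow> real" where
  "lam \<sigma> = (\<Prod>k\<in>\<sigma>. 1 + real k)"

definition S_p :: "(nat \<Rightarrow> real) measure \<Rightarrow> real \<Rightarrow> (nat \<Rightarrow> real) l2 set" where
  "S_p M p = {\<xi> \<in> L2 M. (\<lambda>\<sigma>. lam \<sigma> powr (2 * p) * (cmod (l2_inner M (Z M \<sigma>) \<xi>))\<^sup>2) summable_on Gam}"

definition S_space :: "(nat \<Rightarrow> real) measure \<Rightarrow> (nat \<Rightarrow> real) l2 set" where
  "S_space M = (\<Inter>p\<in>{0..}. S_p M p)"

definition numerical_density ::
  "(nat \<Rightarrow> real) measure \<Rightarrow> ((nat \<Rightarrow> real) set \<Rightarrow> (nat \<Rightarrow> real) l2 \<Rightarrow> (nat \<Rightarrow> real) l2)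
    \<Rightarrow> nat set \<Rightarrow> nat set \<Rightarrow> (nat \<Rightarrow> real) l2 \<Rightarrow> bool" where
  "numerical_density M \<pi> \<sigma> \<tau> \<phi> \<longleftrightarrow>
     \<phi> \<in> S_space M \<and>
     (\<forall>E\<in>sets M. l2_inner M (\<pi> E (Z M \<sigma>)) (Z M \<tau>) = (LINT \<omega>:E|M. rep \<phi> \<omega>))"

definition S_smooth ::
  "(nat \<Rightarrow> real) measure \<Rightarrow> ((nat \<Rightarrow> real) set \<Rightarrow> (nat \<Rightarrow> real) l2 \<Rightarrow> (nat \<Rightarrow> real) l2) \<Rightarrow> bool" where
  "S_smooth M \<pi> \<longleftrightarrow>
     spectral_measure M \<pi> \<and> (\<forall>\<sigma>\<in>Gam. \<forall>\<tau>\<in>Gam. \<exists>\<phi>. numerical_density M \<pi> \<sigma> \<tau> \<phi>)"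

end

theory Submission
  imports Defs
begin

text \<open>On \<open>Sig\<close> each coordinate squares to one, so \<open>Z\<^sub>\<sigma> Z\<^sub>\<tau> = Z\<^bsub>\<sigma>\<triangle>\<tau>\<^esub>\<close> pointwise and
  \<open>\<langle>1\<^sub>E Z\<^sub>\<sigma>, Z\<^sub>\<tau>\<rangle>\<close> is the integral of \<open>Z\<^bsub>\<sigma>\<triangle>\<tau>\<^esub>\<close> over \<open>E\<close>.  In the symmetric case the \<open>Z\<^sub>\<sigma>\<close> are
  orthonormal, so the series defining membership of a fixed \<open>Z\<^sub>\<rho>\<close> in the weighted spaces has a
  single nonzero term.  A density is determined by its integrals over all measurable sets.\<close>

section \<open>Calculus of square integrable classes\<close>

lemma sq_integrableD:
  assumes "f \<in> sq_integrable M"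
  shows "f \<in> borel_measurable M" "integrable M (\<lambda>x. (cmod (f x))\<^sup>2)"
  using assms by (auto simp: sq_integrable_def)

text \<open>The squared modulus of the product is dominated by \<open>C\<^sup>2\<close> times that
  of \<open>f\<close>. Constants and indicators are both bounded multipliers, so scaling and
  restriction to a measurable set are covered at once.\<close>

lemma sq_integrable_mult_bounded:
  assumes f: "f \<in> sq_integrable M" and h: "h \<in> borel_measurable M"
    and bound: "\<And>x. cmod (h x) \<le> C"
  shows "(\<lambda>x. h x * f x) \<in> sq_integrable M"
proof -
  note [measurable] = sq_integrableD(1)[OF f] h
  have "(cmod (h x * f x))\<^sup>2 \<le> C\<^sup>2 * (cmod (f x))\<^sup>2" for x
    using power_mono[OF bound[of x], of 2]
    by (simp add: norm_mult power_mult_distrib mult_right_mono)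
  then have "integrable M (\<lambda>x. (cmod (h x * f x))\<^sup>2)"
    by (intro Bochner_Integration.integrable_bound[OF integrable_mult_right[OF sq_integrableD(2)[OF f], of "C\<^sup>2"]]) auto
  then show ?thesis
    by (simp add: sq_integrable_def)
qed

lemma sq_integrable_scale: "f \<in> sq_integrable M \<Longrightarrow> (\<lambda>x. c * f x) \<in> sq_integrable M"
  by (rule sq_integrable_mult_bounded[where C = "cmod c"]) auto

lemma sq_integrable_indicator:
  assumes "f \<in> sq_integrable M" "E \<in> sets M"
  shows "(\<lambda>x. indicator E x * f x) \<in> sq_integrable M"
  using assms by (intro sq_integrable_mult_bounded[where C = 1]) (auto simp: indicator_def)

lemma sq_integrable_add:
  assumes f: "f \<in> sq_integrable M" and g: "g \<in> sq_integrable M"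
  shows "(\<lambda>x. f x + g x) \<in> sq_integrable M"
proof -
  note [measurable] = sq_integrableD(1)[OF f] sq_integrableD(1)[OF g]
  have "(cmod (f x + g x))\<^sup>2 \<le> 2 * (cmod (f x))\<^sup>2 + 2 * (cmod (g x))\<^sup>2" for x
  proof -
    have "(cmod (f x + g x))\<^sup>2 \<le> (cmod (f x) + cmod (g x))\<^sup>2"
      by (intro power_mono norm_triangle_ineq) simp
    also have "\<dots> \<le> 2 * (cmod (f x))\<^sup>2 + 2 * (cmod (g x))\<^sup>2"
      \<comment> \<open>The mixed term is absorbed by 2ab \<le> a^2 + b^2, which is where the
        factors 2 come from.\<close>
      using sum_squares_bound[of "cmod (f x)" "cmod (g x)"] by (simp add: power2_sum)
    finally show ?thesis .
  qed
  moreover have "integrable M (\<lambda>x. 2 * (cmod (f x))\<^sup>2 + 2 * (cmod (g x))\<^sup>2)"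
    by (intro Bochner_Integration.integrable_add integrable_mult_right sq_integrableD(2)[OF f] sq_integrableD(2)[OF g])
  ultimately have "integrable M (\<lambda>x. (cmod (f x + g x))\<^sup>2)"
    by (intro Bochner_Integration.integrable_bound[OF \<open>integrable M (\<lambda>x. 2 * (cmod (f x))\<^sup>2 + 2 * (cmod (g x))\<^sup>2)\<close>])
      simp_all
  then show ?thesis
    by (simp add: sq_integrable_def)
qed

lemma sq_integrable_diff:
  assumes "f \<in> sq_integrable M" "g \<in> sq_integrable M"
  shows "(\<lambda>x. f x - g x) \<in> sq_integrable M"
  using sq_integrable_add[OF assms(1) sq_integrable_scale[OF assms(2), of "-1"]] by simp

section \<open>Classes modulo equality almost everywhere\<close>

lemma equiv_ae_rel: "equiv (sq_integrable M) (ae_rel M)"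
proof (rule equivI)
  show "ae_rel M \<subseteq> sq_integrable M \<times> sq_integrable M"
    by (auto simp: ae_rel_def)
  show "refl_on (sq_integrable M) (ae_rel M)"
    by (auto simp: refl_on_def ae_rel_def)
  show "sym (ae_rel M)"
    by (auto simp: sym_def ae_rel_def eq_commute)
  show "trans (ae_rel M)"
  proof (rule transI)
    fix f g h assume fg: "(f, g) \<in> ae_rel M" and gh: "(g, h) \<in> ae_rel M"
    then have "AE x in M. f x = g x" "AE x in M. g x = h x"
      by (auto simp: ae_rel_def)
    then have "AE x in M. f x = h x"
      by eventually_elim simp
    with fg gh show "(f, h) \<in> ae_rel M"
      by (simp add: ae_rel_def)
  qed
qed

lemma cls_in_L2: "f \<in> sq_integrable M \<Longrightarrow> cls M f \<in> L2 M"
  by (simp add: cls_def L2_def quotientI)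

lemma cls_eq_iff:
  assumes "f \<in> sq_integrable M" "g \<in> sq_integrable M"
  shows "cls M f = cls M g \<longleftrightarrow> (AE x in M. f x = g x)"
  using eq_equiv_class_iff[OF equiv_ae_rel assms] assms
  by (auto simp: cls_def ae_rel_def)

text \<open>Since \<open>rep\<close> is an arbitrary choice, agreement almost everywhere is all that
  is known about it. This is the bridge by which computations with chosen representatives become
  computations with given functions.\<close>

lemma rep_cls:
  assumes "f \<in> sq_integrable M"
  shows "rep (cls M f) \<in> sq_integrable M" "AE x in M. rep (cls M f) x = f x"
proof -
  have "f \<in> cls M f"
    using equiv_class_self[OF equiv_ae_rel assms] by (simp add: cls_def)
  then have "rep (cls M f) \<in> cls M f"
    unfolding rep_def by (rule someI[of "\<lambda>g. g \<in> cls M f"])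
  then have "(f, rep (cls M f)) \<in> ae_rel M"
    by (simp add: cls_def)
  then show "rep (cls M f) \<in> sq_integrable M" "AE x in M. rep (cls M f) x = f x"
    by (auto simp: ae_rel_def eq_commute)
qed

lemma L2_cases:
  assumes "\<xi> \<in> L2 M"
  obtains f where "f \<in> sq_integrable M" "\<xi> = cls M f"
  using assms unfolding L2_def cls_def by (rule quotientE)

lemma
  assumes "\<xi> \<in> L2 M"
  shows rep_sq_integrable: "rep \<xi> \<in> sq_integrable M" and cls_rep: "cls M (rep \<xi>) = \<xi>"
proof -
  obtain f where "f \<in> sq_integrable M" "\<xi> = cls M f"
    using assms by (rule L2_cases)
  then show "rep \<xi> \<in> sq_integrable M" "cls M (rep \<xi>) = \<xi>"
    by (simp_all add: rep_cls cls_eq_iff)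
qed

text \<open>The operations on classes are defined through \<open>rep\<close>; equality almost
  everywhere survives pointwise operations, so any representatives may be used instead.\<close>

lemma l2_add_cls:
  assumes "f \<in> sq_integrable M" "g \<in> sq_integrable M"
  shows "l2_add M (cls M f) (cls M g) = cls M (\<lambda>x. f x + g x)"
  unfolding l2_add_def
proof (subst cls_eq_iff)
  show "AE x in M. rep (cls M f) x + rep (cls M g) x = f x + g x"
    using rep_cls(2)[OF assms(1)] rep_cls(2)[OF assms(2)] by eventually_elim simp
qed (simp_all add: sq_integrable_add rep_cls assms)

lemma l2_diff_cls:
  assumes "f \<in> sq_integrable M" "g \<in> sq_integrable M"
  shows "l2_diff M (cls M f) (cls M g) = cls M (\<lambda>x. f x - g x)"
  unfolding l2_diff_def
proof (subst cls_eq_iff)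
  show "AE x in M. rep (cls M f) x - rep (cls M g) x = f x - g x"
    using rep_cls(2)[OF assms(1)] rep_cls(2)[OF assms(2)] by eventually_elim simp
qed (simp_all add: sq_integrable_diff rep_cls assms)

lemma l2_scale_cls:
  assumes "f \<in> sq_integrable M"
  shows "l2_scale M c (cls M f) = cls M (\<lambda>x. c * f x)"
  unfolding l2_scale_def
proof (subst cls_eq_iff)
  show "AE x in M. c * rep (cls M f) x = c * f x"
    using rep_cls(2)[OF assms] by eventually_elim simp
qed (simp_all add: sq_integrable_scale rep_cls assms)

lemma canonical_cls:
  assumes "f \<in> sq_integrable M" "E \<in> sets M"
  shows "canonical_spectral_measure M E (cls M f) = cls M (\<lambda>x. indicator E x * f x)"
  unfolding canonical_spectral_measure_def
proof (subst cls_eq_iff)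
  show "AE x in M. indicator E x * rep (cls M f) x = indicator E x * f x"
    using rep_cls(2)[OF assms(1)] by eventually_elim simp
qed (simp_all add: sq_integrable_indicator rep_cls assms)

lemma l2_inner_cls:
  assumes f: "f \<in> sq_integrable M" and g: "g \<in> sq_integrable M"
  shows "l2_inner M (cls M f) (cls M g) = (LINT x|M. cnj (f x) * g x)"
proof -
  note meas = sq_integrableD(1)[OF f] sq_integrableD(1)[OF g]
    sq_integrableD(1)[OF rep_cls(1)[OF f]] sq_integrableD(1)[OF rep_cls(1)[OF g]]
  have cnj: "(\<lambda>x. cnj (h x)) \<in> borel_measurable M" if "h \<in> borel_measurable M" for h
    using that by (rule borel_measurable_continuous_on[OF continuous_on_cnj[OF continuous_on_id]])
  show ?thesis
    unfolding l2_inner_def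
  proof (rule integral_cong_AE)
    show "AE x in M. cnj (rep (cls M f) x) * rep (cls M g) x = cnj (f x) * g x"
      using rep_cls(2)[OF f] rep_cls(2)[OF g] by eventually_elim simp
  qed (intro borel_measurable_times cnj meas)+
qed

lemma l2_norm_cls:
  assumes f: "f \<in> sq_integrable M"
  shows "l2_norm M (cls M f) = sqrt (LINT x|M. (cmod (f x))\<^sup>2)"
proof -
  have "cnj (f x) * f x = complex_of_real ((cmod (f x))\<^sup>2)" for x
    by (simp add: complex_norm_square mult.commute del: of_real_power)
  then show ?thesis
    by (simp add: l2_norm_def l2_inner_cls[OF f f] del: of_real_power)
qed

section \<open>Multiplication by indicators as a spectral measure\<close>

text \<open>An indicator is its own square, which gives idempotence; it is real, which gives
  self-adjointness; it is at most 1, which gives the operator bound with constant 1.\<close>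

lemma orthogonal_projection_canonical:
  assumes E: "E \<in> sets M"
  shows "orthogonal_projection M (canonical_spectral_measure M E)"
proof -
  let ?P = "canonical_spectral_measure M E"
  have "l2_norm M (?P \<xi>) \<le> 1 * l2_norm M \<xi>" if "\<xi> \<in> L2 M" for \<xi>
    using that
  proof (rule L2_cases)
    fix f assume f: "f \<in> sq_integrable M" "\<xi> = cls M f"
    have "(LINT x|M. (cmod (indicator E x * f x))\<^sup>2) \<le> (LINT x|M. (cmod (f x))\<^sup>2)"
      using sq_integrableD(2)[OF sq_integrable_indicator[OF f(1) E]] sq_integrableD(2)[OF f(1)]
      by (intro integral_mono) (auto simp: indicator_def)
    then show ?thesis
      by (simp add: f l2_norm_cls canonical_cls sq_integrable_indicator E)
  qed
  moreover have "?P \<xi> \<in> L2 M" "?P (?P \<xi>) = ?P \<xi>" "?P (l2_scale M c \<xi>) = l2_scale M c (?P \<xi>)"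
    if \<xi>: "\<xi> \<in> L2 M" for c \<xi>
  proof -
    obtain f where f: "f \<in> sq_integrable M" "\<xi> = cls M f"
      using \<xi> by (rule L2_cases)
    have "(\<lambda>x. indicator E x * (indicator E x * f x)) = (\<lambda>x. indicator E x * f x)"
      by (simp add: indicator_def fun_eq_iff)
    then show "?P \<xi> \<in> L2 M" "?P (?P \<xi>) = ?P \<xi>" "?P (l2_scale M c \<xi>) = l2_scale M c (?P \<xi>)"
      using f(1) E unfolding f(2)
      by (simp_all add: canonical_cls l2_scale_cls cls_in_L2 sq_integrable_scale
          sq_integrable_indicator mult.left_commute del: mult_cancel_left mult_cancel_left1)
  qed
  moreover have "?P (l2_add M \<xi> \<eta>) = l2_add M (?P \<xi>) (?P \<eta>)"
    "l2_inner M (?P \<xi>) \<eta> = l2_inner M \<xi> (?P \<eta>)"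
    if \<xi>: "\<xi> \<in> L2 M" and \<eta>: "\<eta> \<in> L2 M" for \<xi> \<eta>
  proof -
    obtain f g where fg: "f \<in> sq_integrable M" "\<xi> = cls M f" "g \<in> sq_integrable M" "\<eta> = cls M g"
      using \<xi> \<eta> by (meson L2_cases)
    have "(\<lambda>x. cnj (indicator E x * f x) * g x) = (\<lambda>x. cnj (f x) * (indicator E x * g x))"
      by (simp add: indicator_def fun_eq_iff)
    then show "?P (l2_add M \<xi> \<eta>) = l2_add M (?P \<xi>) (?P \<eta>)"
      "l2_inner M (?P \<xi>) \<eta> = l2_inner M \<xi> (?P \<eta>)"
      using fg(1,3) E unfolding fg(2,4)
      by (simp_all add: canonical_cls l2_add_cls l2_inner_cls sq_integrable_add
          sq_integrable_indicator distrib_left del: complex_cnj_mult)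
  qed
  ultimately show ?thesis
    unfolding orthogonal_projection_def bounded_operator_def
    by (intro conjI ballI allI exI[of _ 1]) assumption+
qed

text \<open>By disjointness the indicators add up to the indicator of the union, so a partial sum is
  again a single cut-off of \<open>f\<close>.\<close>

lemma l2_partial_sum_canonical:
  assumes f: "f \<in> sq_integrable M" and E: "range E \<subseteq> sets M" and disj: "disjoint_family E"
  shows "l2_partial_sum M (\<lambda>n. canonical_spectral_measure M (E n) (cls M f)) N
    = cls M (\<lambda>x. indicator (\<Union>n<N. E n) x * f x)"
proof (induction N)
  case 0
  then show ?case by simp
next
  case (Suc N)
  have sets: "E n \<in> sets M" "(\<Union>n<N. E n) \<in> sets M" for n N
    using E by auto
  have "E n \<inter> E N = {}" if "n < N" for n
    using disjoint_family_onD[OF disj] that by simp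
  then have "(\<Union>n<N. E n) \<inter> E N = {}"
    by blast
  then have "indicator (\<Union>n<Suc N. E n) x = (indicator (\<Union>n<N. E n) x + indicator (E N) x :: complex)" for x
    by (subst indicator_add) (auto simp: lessThan_Suc Un_commute)
  then show ?case
    unfolding l2_partial_sum.simps Suc using f sets
    by (simp add: canonical_cls l2_add_cls sq_integrable_indicator distrib_right)
qed

text \<open>Strong convergence is dominated convergence: the indicators of the finite unions
  converge pointwise to that of the full union, and the squared modulus of \<open>f\<close> is an
  integrable majorant.\<close>

lemma canonical_countably_additive:
  assumes E: "range E \<subseteq> sets M" and disj: "disjoint_family E" and \<xi>: "\<xi> \<in> L2 M"
  shows "(\<lambda>N. l2_norm M (l2_diff M
      (l2_partial_sum M (\<lambda>n. canonical_spectral_measure M (E n) \<xi>) N)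
      (canonical_spectral_measure M (\<Union>n. E n) \<xi>))) \<longlonglongrightarrow> 0"
proof -
  obtain f where f: "f \<in> sq_integrable M" "\<xi> = cls M f"
    using \<xi> by (rule L2_cases)
  define A where "A N = (\<Union>n<N. E n)" for N
  define B where "B = (\<Union>n. E n)"
  have [measurable]: "A N \<in> sets M" "B \<in> sets M" for N
    using E by (auto simp: A_def B_def)
  note [measurable] = sq_integrableD(1)[OF f(1)]
  let ?d = "\<lambda>N x. indicator (A N) x * f x - indicator B x * f x"
  have "(\<lambda>N. LINT x|M. (cmod (?d N x))\<^sup>2) \<longlonglongrightarrow> (LINT x|M. 0)"
  proof (rule integral_dominated_convergence[where w = "\<lambda>x. (cmod (f x))\<^sup>2"])
    have "(\<lambda>N. indicator (A N) x :: complex) \<longlonglongrightarrow> indicator B x" for x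
      unfolding A_def B_def by (rule LIMSEQ_indicator_UN)
    then have "(\<lambda>N. (cmod (?d N x))\<^sup>2) \<longlonglongrightarrow> (cmod (indicator B x * f x - indicator B x * f x))\<^sup>2" for x
      by (intro tendsto_intros)
    then show "AE x in M. (\<lambda>N. (cmod (?d N x))\<^sup>2) \<longlonglongrightarrow> 0"
      by simp
    \<comment> \<open>As \<open>A N\<close> is contained in \<open>B\<close>, the difference is
      either 0 or \<open>- f x\<close>, so no factor is lost in the majorant.\<close>
    show "AE x in M. norm ((cmod (?d N x))\<^sup>2) \<le> (cmod (f x))\<^sup>2" for N
      by (auto simp: indicator_def A_def B_def)
  qed (auto simp: sq_integrableD(2)[OF f(1)])
  then have "(\<lambda>N. sqrt (LINT x|M. (cmod (?d N x))\<^sup>2)) \<longlonglongrightarrow> 0"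
    using tendsto_real_sqrt by fastforce
  then show ?thesis
    unfolding f(2) l2_partial_sum_canonical[OF f(1) E disj]
    by (simp add: canonical_cls l2_diff_cls l2_norm_cls sq_integrable_indicator
        sq_integrable_diff f(1) flip: A_def B_def)
qed

lemma spectral_measure_canonical: "spectral_measure M (canonical_spectral_measure M)"
  unfolding spectral_measure_def
proof (intro conjI ballI allI impI)
  fix \<xi> assume "\<xi> \<in> L2 M"
  then obtain f where f: "f \<in> sq_integrable M" "\<xi> = cls M f"
    by (rule L2_cases)
  then show "canonical_spectral_measure M (space M) \<xi> = \<xi>"
    by (simp add: canonical_cls cls_eq_iff sq_integrable_indicator)
qed (rule orthogonal_projection_canonical canonical_countably_additive; assumption)+

section \<open>Integrability and uniqueness of densities\<close>

lemma (in finite_measure) sq_integrable_imp_integrable: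
  assumes "f \<in> sq_integrable M"
  shows "integrable M f"
  using sq_integrableD[OF assms] square_integrable_imp_integrable[of "\<lambda>x. cmod (f x)"]
  by (simp add: integrable_norm_iff)

text \<open>Taking real and imaginary parts commutes with integration, so uniqueness of real
  densities applies to each part separately.\<close>

lemma complex_density_unique:
  fixes f g :: "'a \<Rightarrow> complex"
  assumes f: "integrable M f" and g: "integrable M g"
    and eq: "\<And>A. A \<in> sets M \<Longrightarrow> (LINT x:A|M. f x) = (LINT x:A|M. g x)"
  shows "AE x in M. f x = g x"
proof -
  have Re: "(LINT x:A|M. Re (h x)) = Re (LINT x:A|M. h x)"
    and Im: "(LINT x:A|M. Im (h x)) = Im (LINT x:A|M. h x)"
    if "A \<in> sets M" "integrable M h" for A and h :: "'a \<Rightarrow> complex"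
    using integral_Re[OF integrable_mult_indicator[OF that]]
      integral_Im[OF integrable_mult_indicator[OF that]]
    by (simp_all add: set_lebesgue_integral_def)
  have "AE x in M. Re (f x) = Re (g x)" "AE x in M. Im (f x) = Im (g x)"
    by (intro density_unique_real; simp add: f g Re Im eq)+
  then show ?thesis
    by eventually_elim (rule complex_eqI)
qed

section \<open>The Walsh functions\<close>

text \<open>A real-valued representative of \<open>Z M \<sigma>\<close>, kept outside the quotient
  so that identities can be proved pointwise on \<open>Sig\<close>.\<close>

definition walsh :: "nat set \<Rightarrow> (nat \<Rightarrow> real) \<Rightarrow> real" where
  "walsh \<sigma> \<omega> = (\<Prod>i\<in>\<sigma>. zeta i \<omega>)"

lemma Z_walsh: "Z M \<sigma> = cls M (\<lambda>\<omega>. complex_of_real (walsh \<sigma> \<omega>))"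
  by (simp add: Z_def walsh_def)

lemma zeta_Sig: "\<omega> \<in> Sig \<Longrightarrow> zeta i \<omega> = -1 \<or> zeta i \<omega> = 1"
  by (auto simp: Sig_def zeta_def PiE_def Pi_def)

lemma abs_zeta: "\<omega> \<in> Sig \<Longrightarrow> \<bar>zeta i \<omega>\<bar> = 1"
  using zeta_Sig[of \<omega> i] by auto

lemma abs_walsh: "\<omega> \<in> Sig \<Longrightarrow> \<bar>walsh \<sigma> \<omega>\<bar> = 1"
  by (simp add: walsh_def abs_prod abs_zeta)

text \<open>The factors indexed by \<open>\<sigma> \<inter> \<tau>\<close> appear squared and hence drop out.\<close>

lemma walsh_mult:
  assumes "\<omega> \<in> Sig" "finite \<sigma>" "finite \<tau>"
  shows "walsh \<sigma> \<omega> * walsh \<tau> \<omega> = walsh ((\<sigma> - \<tau>) \<union> (\<tau> - \<sigma>)) \<omega>"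
proof -
  let ?W = "\<lambda>A. walsh A \<omega>"
  have split: "?W A = ?W (A \<inter> B) * ?W (A - B)" if "finite A" for A B
    unfolding walsh_def using that by (rule prod.Int_Diff)
  have "?W \<sigma> * ?W \<tau> = (?W (\<sigma> \<inter> \<tau>) * ?W (\<sigma> \<inter> \<tau>)) * (?W (\<sigma> - \<tau>) * ?W (\<tau> - \<sigma>))"
    using split[of \<sigma> \<tau>] split[of \<tau> \<sigma>] assms by (simp add: Int_commute mult_ac)
  also have "?W (\<sigma> \<inter> \<tau>) * ?W (\<sigma> \<inter> \<tau>) = 1"
    using abs_walsh[OF assms(1), of "\<sigma> \<inter> \<tau>"] by (metis abs_mult_self_eq mult_1)
  also have "?W (\<sigma> - \<tau>) * ?W (\<tau> - \<sigma>) = ?W ((\<sigma> - \<tau>) \<union> (\<tau> - \<sigma>))"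
    unfolding walsh_def using assms by (intro prod.union_disjoint[symmetric]) auto
  finally show ?thesis by simp
qed

context bernoulli_space
begin

lemma zeta_measurable [measurable]: "zeta i \<in> borel_measurable M"
  using indep_zeta by (simp add: indep_vars_def)

lemma walsh_measurable [measurable]: "walsh \<sigma> \<in> borel_measurable M"
  unfolding walsh_def[abs_def] by measurable

text \<open>The square is identically 1 on \<open>space M\<close>, and constants are integrable for
  a probability measure.\<close>

lemma walsh_sq_integrable: "(\<lambda>\<omega>. complex_of_real (walsh \<sigma> \<omega>)) \<in> sq_integrable M"
proof -
  have "integrable M (\<lambda>\<omega>. (walsh \<sigma> \<omega>)\<^sup>2) \<longleftrightarrow> integrable M (\<lambda>_. 1::real)"
    by (intro Bochner_Integration.integrable_cong refl) (metis abs_walsh space_eq power2_abs one_power2)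
  then show ?thesis
    by (simp add: sq_integrable_def)
qed

lemma Z_in_L2: "Z M \<sigma> \<in> L2 M"
  by (simp add: Z_walsh cls_in_L2 walsh_sq_integrable)

section \<open>Expectations and orthonormality\<close>

lemma zeta_integrable: "integrable M (zeta i)"
proof (rule integrable_const_bound[where B = 1])
  show "AE \<omega> in M. norm (zeta i \<omega>) \<le> 1"
    by (intro AE_I2) (simp add: space_eq abs_zeta)
qed simp

lemma expectation_zeta: "expectation (zeta i) = 2 * \<theta> i - 1"
proof -
  have [measurable]: "{\<omega> \<in> space M. zeta i \<omega> = c} \<in> sets M" for c by measurable
  \<comment> \<open>A variable with values 1 and -1 is the difference of the indicators of its two
    level sets, so its mean is the difference of the two given probabilities.\<close>
  have "expectation (zeta i) = expectation (\<lambda>\<omega>. indicator {\<omega> \<in> space M. zeta i \<omega> = 1} \<omega>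
      - indicator {\<omega> \<in> space M. zeta i \<omega> = -1} \<omega>)"
    using zeta_Sig by (intro Bochner_Integration.integral_cong refl)
      (fastforce simp: space_eq indicator_def)
  also have "\<dots> = prob {\<omega> \<in> space M. zeta i \<omega> = 1} - prob {\<omega> \<in> space M. zeta i \<omega> = -1}"
    by (subst Bochner_Integration.integral_diff) (auto simp: integrable_indicator_iff emeasure_eq_measure)
  finally show ?thesis
    by (simp add: prob_pos prob_neg)
qed

text \<open>Independence turns the expectation of a finite product into the product of the
  expectations.\<close>

lemma expectation_walsh:
  assumes "finite \<sigma>"
  shows "expectation (walsh \<sigma>) = (\<Prod>i\<in>\<sigma>. 2 * \<theta> i - 1)"
  unfolding walsh_def[abs_def]
  using indep_vars_lebesgue_integral[OF assms indep_vars_subset[OF indep_zeta subset_UNIV] zeta_integrable]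
  by (simp add: expectation_zeta)

text \<open>The inner product is the expectation of the Walsh function of the symmetric difference.
  For \<theta> = 1/2 every factor of that expectation is 0, so only the empty product survives, and
  the symmetric difference is empty exactly when the index sets agree.\<close>

lemma l2_inner_Z:
  assumes sym: "\<And>n. \<theta> n = 1 / 2" and fin: "finite \<sigma>" "finite \<tau>"
  shows "l2_inner M (Z M \<sigma>) (Z M \<tau>) = (if \<sigma> = \<tau> then 1 else 0)"
proof -
  have "l2_inner M (Z M \<sigma>) (Z M \<tau>) = (LINT \<omega>|M. complex_of_real (walsh ((\<sigma> - \<tau>) \<union> (\<tau> - \<sigma>)) \<omega>))"
    unfolding Z_walsh l2_inner_cls[OF walsh_sq_integrable walsh_sq_integrable]
    using fin by (intro Bochner_Integration.integral_cong refl)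
      (simp add: space_eq flip: walsh_mult)
  also have "\<dots> = complex_of_real (\<Prod>i\<in>(\<sigma> - \<tau>) \<union> (\<tau> - \<sigma>). 2 * \<theta> i - 1)"
    using fin by (simp add: expectation_walsh del: of_real_prod)
  also have "\<dots> = (if \<sigma> = \<tau> then 1 else 0)"
    using fin by (auto simp: sym)
  finally show ?thesis .
qed

lemma Z_in_S_space:
  assumes sym: "\<And>n. \<theta> n = 1 / 2" and fin: "finite \<sigma>"
  shows "Z M \<sigma> \<in> S_space M"
proof -
  have "(\<lambda>\<rho>. lam \<rho> powr (2 * p) * (cmod (l2_inner M (Z M \<rho>) (Z M \<sigma>)))\<^sup>2) summable_on Gam" for p
  \<comment> \<open>Orthonormality kills every term with \<rho> \<noteq> \<sigma>, whatever the
    weight, so for each \<open>p\<close> summability reduces to a singleton.\<close>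
  proof (subst summable_on_cong_neutral[where S = Gam and T = "{\<sigma>}"])
    show "(\<lambda>\<rho>. lam \<rho> powr (2 * p) * (cmod (l2_inner M (Z M \<rho>) (Z M \<sigma>)))\<^sup>2) summable_on {\<sigma>}"
      by (rule summable_on_finite) simp
  qed (auto simp: Gam_def l2_inner_Z[OF sym] fin)
  then show ?thesis
    by (auto simp: S_space_def S_p_def Z_in_L2)
qed

section \<open>The density of the canonical spectral measure\<close>

lemma l2_inner_canonical_Z:
  assumes fin: "finite \<sigma>" "finite \<tau>" and E: "E \<in> sets M"
  shows "l2_inner M (canonical_spectral_measure M E (Z M \<sigma>)) (Z M \<tau>)
    = (LINT \<omega>:E|M. rep (Z M ((\<sigma> - \<tau>) \<union> (\<tau> - \<sigma>))) \<omega>)"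
proof -
  let ?D = "(\<sigma> - \<tau>) \<union> (\<tau> - \<sigma>)"
  let ?c = "\<lambda>A \<omega>. complex_of_real (walsh A \<omega>)"
  note sq = walsh_sq_integrable
  have [measurable]: "rep (Z M ?D) \<in> borel_measurable M"
    unfolding Z_walsh by (rule sq_integrableD(1)[OF rep_cls(1)[OF sq]])
  note [measurable] = E
  have "l2_inner M (canonical_spectral_measure M E (Z M \<sigma>)) (Z M \<tau>)
      = (LINT \<omega>|M. cnj (indicator E \<omega> * ?c \<sigma> \<omega>) * ?c \<tau> \<omega>)"
    unfolding Z_walsh canonical_cls[OF sq E] l2_inner_cls[OF sq_integrable_indicator[OF sq E] sq] ..
  \<comment> \<open>All factors are real, so conjugation disappears and \<open>walsh_mult\<close>
    merges the two Walsh functions.\<close>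
  also have "\<dots> = (LINT \<omega>:E|M. ?c ?D \<omega>)"
    unfolding set_lebesgue_integral_def using fin
    by (intro Bochner_Integration.integral_cong refl)
      (simp add: space_eq indicator_def flip: walsh_mult)
  \<comment> \<open>Densities are stated through \<open>rep\<close>, which agrees with the Walsh
    function almost everywhere.\<close>
  also have "\<dots> = (LINT \<omega>:E|M. rep (Z M ?D) \<omega>)"
    unfolding set_lebesgue_integral_def
  proof (rule integral_cong_AE)
    show "AE \<omega> in M. indicator E \<omega> *\<^sub>R ?c ?D \<omega> = indicator E \<omega> *\<^sub>R rep (Z M ?D) \<omega>"
      unfolding Z_walsh using rep_cls(2)[OF sq, of ?D] by eventually_elim simp
  qed measurable
  finally show ?thesis .
qed

text \<open>One direction is the integral formula together with membership in
  \<open>S_space\<close>. Conversely, a density has the same integrals over all measurable sets as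
  the Walsh class, hence agrees with it almost everywhere and is the same class.\<close>

lemma numerical_density_canonical_iff:
  assumes sym: "\<And>n. \<theta> n = 1 / 2" and fin: "finite \<sigma>" "finite \<tau>"
  shows "numerical_density M (canonical_spectral_measure M) \<sigma> \<tau> \<phi>
    \<longleftrightarrow> \<phi> = Z M ((\<sigma> - \<tau>) \<union> (\<tau> - \<sigma>))"
proof
  let ?D = "(\<sigma> - \<tau>) \<union> (\<tau> - \<sigma>)"
  show "numerical_density M (canonical_spectral_measure M) \<sigma> \<tau> \<phi>" if "\<phi> = Z M ?D"
    using that fin by (simp add: numerical_density_def Z_in_S_space[OF sym] l2_inner_canonical_Z)
  assume dens: "numerical_density M (canonical_spectral_measure M) \<sigma> \<tau> \<phi>"
  \<comment> \<open>The exponent 0 is a convenient member of the intersection; it serves to extract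
    membership in \<open>L2 M\<close>.\<close>
  then have "\<phi> \<in> S_p M 0"
    by (auto simp: numerical_density_def S_space_def)
  then have \<phi>: "\<phi> \<in> L2 M"
    by (simp add: S_p_def)
  have "AE \<omega> in M. rep \<phi> \<omega> = rep (Z M ?D) \<omega>"
    using dens fin
    by (intro complex_density_unique sq_integrable_imp_integrable rep_sq_integrable \<phi> Z_in_L2)
      (simp add: numerical_density_def l2_inner_canonical_Z)
  then have "cls M (rep \<phi>) = cls M (rep (Z M ?D))"
    by (simp add: cls_eq_iff rep_sq_integrable \<phi> Z_in_L2)
  then show "\<phi> = Z M ?D"
    by (simp add: cls_rep \<phi> Z_in_L2)
qed

end

theorem theorem5p1:
  fixes \<theta> :: "nat \<Rightarrow> real" and M :: "(nat \<Rightarrow> real) measure"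
  assumes "bernoulli_space \<theta> M"
    and "\<And>n. \<theta> n = 1 / 2"
  shows "S_smooth M (canonical_spectral_measure M) \<and>
    (\<forall>\<sigma>\<in>Gam. \<forall>\<tau>\<in>Gam. \<forall>\<phi>.
       numerical_density M (canonical_spectral_measure M) \<sigma> \<tau> \<phi>
         \<longleftrightarrow> \<phi> = Z M ((\<sigma> - \<tau>) \<union> (\<tau> - \<sigma>)))"
  \<comment> \<open>Read from right to left, the equivalence also supplies the density whose
    existence smoothness demands.\<close>
  using bernoulli_space.numerical_density_canonical_iff[OF assms]
  by (simp add: S_smooth_def Gam_def spectral_measure_canonical)

end
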